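(* Let $k,m$ be integers with $1<k\le m$. Then for every positive integer $n$, $$q^*_{k,m}(n)=\sum_{d^m\delta=n}\mu_{k,m}(\delta),$$ $$\mu_{k,m}(n)=\sum_{d^m\delta=n}\mu(d)\,q^*_{k,m}(\delta),$$ where both sums run over all pairs $(d,\delta)$ of positive integers with $d^m\delta=n$, and $\mu$ is the classical Möbius function.
   Context: Let $k,m$ be integers with $1<k\le m$. The generalized Möbius function $\mu_{k,m}$ is the multiplicative function on the positive integers (with $\mu_{k,m}(1)=1$) whose values at prime powers $p^\alpha$, $\alpha\ge 0$, are: $\mu_{k,m}(p^\alpha)=1$ if $0\le\alpha<k$; $\mu_{k,m}(p^\alpha)=0$ if $k\le\alpha<m$; $\mu_{k,m}(p^\alpha)=-1$ if $\alpha=m$; $\mu_{k,m}(p^\alpha)=0$ if $\alpha>m$. (For $m=k$ the second case is empty and $\mu_{k,k}=\mu_k$ is Apostol's Möbius function of order $k$.) The set $Q^*_{k,m}$ consists of the positive integers $n$ such that for every prime $p$ dividing $n$, the exponent of $p$ in the factorization of $n$ leaves a remainder between $1$ and $k-1$ (inclusive) upon division by $m$; in particular $1\in Q^*_{k,m}$. The function $q^*_{k,m}$ is the characteristic function of $Q^*_{k,m}$: $q^*_{k,m}(n)=1$ if $n\in Q^*_{k,m}$ and $0$ otherwise. *)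

theory Defs
  imports "HOL-Computational_Algebra.Computational_Algebra" "HOL-Library.Indicator_Function"
begin

definition moebius_mu :: "nat \<Rightarrow> int" where
  "moebius_mu n = (if squarefree n then (-1) ^ card (prime_factors n) else 0)"

definition gen_moebius_pp :: "nat \<Rightarrow> nat \<Rightarrow> nat \<Rightarrow> int" where
  "gen_moebius_pp k m \<alpha> =
     (if \<alpha> < k then 1 else if \<alpha> < m then 0 else if \<alpha> = m then -1 else 0)"

text \<open>The multiplicative function on the positive integers with value
  \<^term>\<open>gen_moebius_pp k m \<alpha>\<close> at every prime power \<open>p ^ \<alpha>\<close>; see
  \<open>gen_moebius_coprime_mult\<close> and \<open>gen_moebius_prime_power\<close> below. The value at \<open>0\<close>
  is irrelevant.\<close>

definition gen_moebius :: "nat \<Rightarrow> nat \<Rightarrow> nat \<Rightarrow> int" where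
  "gen_moebius k m n = (\<Prod>p\<in>prime_factors n. gen_moebius_pp k m (multiplicity p n))"

definition Qstar :: "nat \<Rightarrow> nat \<Rightarrow> nat set" where
  "Qstar k m = {n. n > 0 \<and>
     (\<forall>p. prime p \<and> p dvd n \<longrightarrow> multiplicity p n mod m \<in> {1..k - 1})}"

definition qstar :: "nat \<Rightarrow> nat \<Rightarrow> nat \<Rightarrow> int" where
  "qstar k m n = indicator (Qstar k m) n"

definition power_factor_pairs :: "nat \<Rightarrow> nat \<Rightarrow> (nat \<times> nat) set" where
  "power_factor_pairs m n = {(d, \<delta>). d > 0 \<and> \<delta> > 0 \<and> d ^ m * \<delta> = n}"

lemma finite_power_factor_pairs:
  assumes "m > 0"
  shows "finite (power_factor_pairs m n)"
proof (rule finite_subset)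
  show "power_factor_pairs m n \<subseteq> {..n} \<times> {..n}"
  proof (clarsimp simp: power_factor_pairs_def)
    fix d \<delta> :: nat
    assume "d > 0" "\<delta> > 0"
    have "d \<le> d ^ m"
      using \<open>d > 0\<close> \<open>m > 0\<close> by (simp add: self_le_power)
    also have "\<dots> \<le> d ^ m * \<delta>"
      using \<open>\<delta> > 0\<close> by simp
    finally show "d \<le> d ^ m * \<delta>" .
  qed
qed auto

lemma gen_moebius_1: "gen_moebius k m 1 = 1"
  by (simp add: gen_moebius_def)

lemma gen_moebius_prime_power:
  assumes "prime p" "0 < k"
  shows "gen_moebius k m (p ^ \<alpha>) = gen_moebius_pp k m \<alpha>"
proof (cases "\<alpha> = 0")
  case True
  then show ?thesis
    using assms by (simp add: gen_moebius_def gen_moebius_pp_def)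
next
  case False
  then have "prime_factors (p ^ \<alpha>) = {p}"
    using assms by (auto simp: prime_factors_dvd prime_dvd_power_iff primes_dvd_imp_eq prime_gt_0_nat)
  moreover have "multiplicity p (p ^ \<alpha>) = \<alpha>"
    using assms by (simp add: prime_elem_multiplicity_power_distrib)
  ultimately show ?thesis
    by (simp add: gen_moebius_def)
qed

lemma gen_moebius_coprime_mult:
  assumes "coprime a b" "0 < a" "0 < b"
  shows "gen_moebius k m (a * b) = gen_moebius k m a * gen_moebius k m b"
proof -
  let ?f = "gen_moebius_pp k m"
  have PF: "prime_factors (a * b) = prime_factors a \<union> prime_factors b"
    using assms by (simp add: prime_factors_product)
  have not_common: False if "prime p" "p dvd a" "p dvd b" for p
    using coprime_common_divisor[OF assms(1) that(2,3)] that(1) not_prime_unit by blast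
  then have disj: "prime_factors a \<inter> prime_factors b = {}"
    by (auto simp: in_prime_factors_iff)
  have mult: "multiplicity p (a * b) = multiplicity p a + multiplicity p b"
    if "prime p" for p
    using that assms by (simp add: prime_elem_multiplicity_mult_distrib)
  have A: "multiplicity p (a * b) = multiplicity p a" if "p \<in> prime_factors a" for p
  proof -
    have "prime p" "\<not> p dvd b"
      using that not_common by (auto simp: in_prime_factors_iff)
    then show ?thesis
      by (simp add: mult not_dvd_imp_multiplicity_0)
  qed
  have B: "multiplicity p (a * b) = multiplicity p b" if "p \<in> prime_factors b" for p
  proof -
    have "prime p" "\<not> p dvd a"
      using that not_common by (auto simp: in_prime_factors_iff)
    then show ?thesis
      by (simp add: mult not_dvd_imp_multiplicity_0)
  qed
  have "gen_moebius k m (a * b) =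
      (\<Prod>p\<in>prime_factors a. ?f (multiplicity p (a * b))) *
      (\<Prod>p\<in>prime_factors b. ?f (multiplicity p (a * b)))"
    unfolding gen_moebius_def PF by (rule prod.union_disjoint) (use disj in auto)
  then show ?thesis
    using A B by (simp add: gen_moebius_def)
qed

end

theory Submission
  imports Defs
begin

text \<open>
  Both identities equate two multiplicative functions of \<open>n\<close>, so they only have to be checked at
  prime powers. The functions \<open>\<mu>\<^bsub>k,m\<^esub>\<close>, \<open>q\<^sup>*\<^bsub>k,m\<^esub>\<close> and \<open>\<mu>\<close> are multiplicative because
  their values are products of contributions that depend on one prime exponent each. The sums inherit multiplicativity from
  their two factors (\<open>multiplicative_power_convolution\<close>): for coprime \<open>a\<close> and \<open>b\<close>, a
  factorization \<open>d\<^sup>m\<delta> = ab\<close> is the product of a unique factorization of \<open>a\<close> and a unique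
  factorization of \<open>b\<close>, of the same form.

  At \<open>n = p\<^sup>\<alpha>\<close> the pairs \<open>(d, \<delta>)\<close> are \<open>(p\<^sup>i, p\<^bsup>\<alpha> - mi\<^esup>)\<close> with \<open>mi \<le> \<alpha>\<close>
  (\<open>power_convolution_prime_power\<close>). In the first identity, the exponents of \<open>\<delta>\<close> run through
  all numbers up to \<open>\<alpha>\<close> that are congruent to \<open>r = \<alpha> mod m\<close>. Among these, \<open>\<mu>\<^bsub>k,m\<^esub>\<close> can only see
  the smallest one, \<open>r\<close>, which contributes \<open>1\<close> if \<open>r < k\<close>, and the exponent \<open>m\<close>, which
  occurs if \<open>r = 0 < \<alpha>\<close> and then cancels that \<open>1\<close>. What is left is \<open>1\<close> exactly if
  \<open>1 \<le> r < k\<close> or \<open>\<alpha> = 0\<close>. In the second identity, only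
  \<open>i = 0\<close> and \<open>i = 1\<close> survive. For \<open>\<alpha> < m\<close> there is only \<open>i = 0\<close>, and both functions agree.
  For \<open>\<alpha> \<ge> m\<close> the sum is the difference of \<open>q\<^sup>*\<^bsub>k,m\<^esub>\<close> at the exponents \<open>\<alpha>\<close> and \<open>\<alpha> - m\<close>.
  As \<open>q\<^sup>*\<^bsub>k,m\<^esub>\<close> is periodic in the exponent except that it is \<open>1\<close> at exponent \<open>0\<close>, this difference
  vanishes for \<open>\<alpha> > m\<close> and equals \<open>-1\<close> for \<open>\<alpha> = m\<close>.
\<close>

section \<open>Multiplicative functions\<close>

definition multiplicative :: "(nat \<Rightarrow> 'a::comm_semiring_1) \<Rightarrow> bool" where
  "multiplicative f \<longleftrightarrow>
     f 1 = 1 \<and> (\<forall>a b. coprime a b \<longrightarrow> a > 0 \<longrightarrow> b > 0 \<longrightarrow> f (a * b) = f a * f b)"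

text \<open>Splitting off the full power of one prime divisor of \<open>n\<close> leaves a smaller coprime
  cofactor, so the values at prime powers propagate to all positive arguments.\<close>

lemma multiplicative_eqI:
  assumes f: "multiplicative f" and g: "multiplicative g"
    and prime_power: "\<And>p \<alpha>. prime p \<Longrightarrow> f (p ^ \<alpha>) = g (p ^ \<alpha>)"
    and "n > 0"
  shows "f n = g n"
  using \<open>n > 0\<close>
proof (induction n rule: less_induct)
  case (less n)
  show ?case
  proof (cases "n = 1")
    case True
    then show ?thesis
      using f g by (simp add: multiplicative_def)
  next
    case False
    then obtain p where p: "prime p" "p dvd n"
      using prime_factor_nat by blast
    have "\<not> is_unit p" "n \<noteq> 0"
      using p(1) less.prems not_prime_unit by auto
    then obtain b where n: "n = p ^ multiplicity p n * b" and "\<not> p dvd b"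
      using multiplicity_decompose' by blast
    have "b > 0"
      using \<open>\<not> p dvd b\<close> by (intro Nat.gr0I) auto
    have "multiplicity p n > 0"
      using p less.prems by (simp add: prime_multiplicity_gt_zero_iff)
    then have "p ^ multiplicity p n > 1"
      using prime_gt_1_nat[OF p(1)] by (intro one_less_power)
    then have "b < n"
      using \<open>b > 0\<close> by (subst n) simp
    have "coprime (p ^ multiplicity p n) b"
      using \<open>\<not> p dvd b\<close> p(1) by (simp add: prime_imp_coprime)
    moreover have "p ^ multiplicity p n > 0"
      using prime_gt_0_nat[OF p(1)] by simp
    ultimately have "h n = h (p ^ multiplicity p n) * h b"
      if "multiplicative h" for h :: "nat \<Rightarrow> 'a"
      using that \<open>b > 0\<close> by (subst n) (simp add: multiplicative_def)
    then have "f n = f (p ^ multiplicity p n) * f b" "g n = g (p ^ multiplicity p n) * g b"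
      using f g by blast+
    then show ?thesis
      using prime_power[OF p(1), of "multiplicity p n"] less.IH[OF \<open>b < n\<close> \<open>b > 0\<close>] by simp
  qed
qed

lemma multiplicative_const_one: "multiplicative (\<lambda>_. 1)"
  by (simp add: multiplicative_def)

lemma multiplicative_gen_moebius: "multiplicative (gen_moebius k m)"
  using gen_moebius_1 gen_moebius_coprime_mult by (auto simp: multiplicative_def)

lemma not_dvd_both_coprime:
  fixes a b p :: nat
  assumes "coprime a b" "prime p" "p dvd a"
  shows "\<not> p dvd b"
  using assms coprime_common_divisor[of a b p] not_prime_unit[of p] by blast

lemma multiplicative_moebius_mu: "multiplicative moebius_mu"
  unfolding multiplicative_def
proof (intro conjI allI impI)
  show "moebius_mu 1 = 1"
    by (simp add: moebius_mu_def)
next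
  fix a b :: nat
  assume ab: "coprime a b" "a > 0" "b > 0"
  have "prime_factors a \<inter> prime_factors b = {}"
    using not_dvd_both_coprime[OF ab(1)] by (auto simp: in_prime_factors_iff)
  then have "card (prime_factors (a * b)) = card (prime_factors a) + card (prime_factors b)"
    using ab by (simp add: prime_factors_product card_Un_disjoint)
  moreover have "squarefree (a * b) \<longleftrightarrow> squarefree a \<and> squarefree b"
    using ab squarefree_mult_coprime squarefree_multD by blast
  ultimately show "moebius_mu (a * b) = moebius_mu a * moebius_mu b"
    by (simp add: moebius_mu_def power_add)
qed

lemma moebius_mu_prime_power:
  assumes "prime p"
  shows "moebius_mu (p ^ i) = (if i = 0 then 1 else if i = 1 then -1 else 0)"
proof -
  have "p \<noteq> 1"
    using assms by auto
  then have "squarefree (p ^ i) \<longleftrightarrow> i = 0 \<or> i = 1"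
    unfolding squarefree_power_iff using squarefree_prime[OF assms] by simp
  then show ?thesis
    using assms by (auto simp: moebius_mu_def prime_prime_factors)
qed

text \<open>The exponent \<open>0\<close> is exceptional: although its remainder is outside \<open>{1..k - 1}\<close>, the
  defining condition of \<^const>\<open>Qstar\<close> holds vacuously at \<open>p ^ 0 = 1\<close>.\<close>

lemma qstar_prime_power:
  assumes "prime p"
  shows "qstar k m (p ^ \<alpha>) = (if \<alpha> = 0 \<or> \<alpha> mod m \<in> {1..k - 1} then 1 else 0)"
proof -
  have "prime q \<and> q dvd p ^ \<alpha> \<longleftrightarrow> q = p \<and> \<alpha> \<noteq> 0" for q
    using assms prime_dvd_power[of q p \<alpha>] primes_dvd_imp_eq[of q p]
    by (cases "\<alpha> = 0") auto
  moreover have "multiplicity p (p ^ \<alpha>) = \<alpha>"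
    using assms by (simp add: prime_elem_multiplicity_power_distrib)
  moreover have "p ^ \<alpha> > 0"
    using prime_gt_0_nat[OF assms] by simp
  ultimately have "p ^ \<alpha> \<in> Qstar k m \<longleftrightarrow> \<alpha> = 0 \<or> \<alpha> mod m \<in> {1..k - 1}"
    unfolding Qstar_def mem_Collect_eq by auto
  then show ?thesis
    by (simp add: qstar_def indicator_def)
qed

lemma multiplicative_qstar: "multiplicative (qstar k m)"
  unfolding multiplicative_def
proof (intro conjI allI impI)
  \<comment> \<open>The argument \<open>1\<close> is read as \<open>2 ^ 0\<close>.\<close>
  show "qstar k m 1 = 1"
    using qstar_prime_power[OF two_is_prime_nat, of k m 0] by simp
next
  fix a b :: nat
  assume ab: "coprime a b" "a > 0" "b > 0"
  have coprime_part: "multiplicity p (x * y) = multiplicity p x"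
    if "prime p" "p dvd x" "coprime x y" "x > 0" "y > 0" for p x y :: nat
  proof -
    have "\<not> p dvd y"
      using that not_dvd_both_coprime by blast
    then show ?thesis
      using that by (simp add: prime_elem_multiplicity_mult_distrib not_dvd_imp_multiplicity_0)
  qed
  have "multiplicity p (a * b) = multiplicity p a" if "prime p" "p dvd a" for p
    using that ab coprime_part by blast
  moreover have "multiplicity p (a * b) = multiplicity p b" if "prime p" "p dvd b" for p
    using that ab coprime_part[of p b a] by (simp add: coprime_commute mult.commute)
  ultimately have "a * b \<in> Qstar k m \<longleftrightarrow> a \<in> Qstar k m \<and> b \<in> Qstar k m"
    using ab by (auto simp: Qstar_def prime_dvd_mult_iff)
  then show "qstar k m (a * b) = qstar k m a * qstar k m b"
    by (simp add: qstar_def indicator_def)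
qed

section \<open>Convolution over factorizations with an m-th power\<close>

definition power_convolution ::
    "nat \<Rightarrow> (nat \<Rightarrow> 'a) \<Rightarrow> (nat \<Rightarrow> 'a) \<Rightarrow> nat \<Rightarrow> 'a::comm_semiring_1" where
  "power_convolution m f g n = (\<Sum>(d, \<delta>)\<in>power_factor_pairs m n. f d * g \<delta>)"

lemma power_factor_pairs_dvd:
  assumes "(d, \<delta>) \<in> power_factor_pairs m n" "m > 0"
  shows "d dvd n" "\<delta> dvd n"
proof -
  have "d dvd d ^ m"
    using \<open>m > 0\<close> by simp
  then show "d dvd n" "\<delta> dvd n"
    using assms by (auto simp: power_factor_pairs_def dest: dvd_mult2)
qed

text \<open>For coprime \<open>a\<close> and \<open>b\<close>, the greatest common divisors with \<open>a\<close> and with \<open>b\<close> recover the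
  two components of a product of a divisor of \<open>a\<close> and a divisor of \<open>b\<close>. Conversely, every divisor
  of \<open>a * b\<close> is such a product. This is the arithmetic behind the bijection
  \<open>bij_betw_power_factor_pairs\<close>.\<close>

lemma gcd_mult_of_coprime_dvds:
  fixes a b u v :: nat
  assumes "coprime a b" "u dvd a" "v dvd b"
  shows "gcd (u * v) a = u" "gcd (u * v) b = v"
proof -
  have "coprime a v" "coprime b u"
    using assms coprime_divisors[of a a v b] coprime_divisors[of u a b b]
    by (simp_all add: coprime_commute)
  then show "gcd (u * v) a = u" "gcd (u * v) b = v"
    using assms by (simp_all add: gcd_mult_left_right_cancel gcd_mult_left_left_cancel)
qed

lemma coprime_split_dvd:
  fixes x a b :: nat
  assumes "coprime a b" "x dvd a * b"
  shows "x = gcd x a * gcd x b"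
proof -
  obtain u v where x: "x = u * v" and "u dvd a" "v dvd b"
    using division_decomp[OF assms(2)] by blast
  then have "gcd x a = u" "gcd x b = v"
    using gcd_mult_of_coprime_dvds[OF assms(1)] by auto
  then show ?thesis
    using x by simp
qed

text \<open>The inverse takes greatest common divisors with \<open>a\<close> and \<open>b\<close> in both components. The point
  to check is that it yields factorizations of \<open>a\<close> and \<open>b\<close> themselves: the two resulting products
  \<open>s\<close> and \<open>t\<close> satisfy \<open>s * t = a * b\<close>, with \<open>s\<close> coprime to \<open>b\<close> and \<open>t\<close> coprime to \<open>a\<close>, which
  forces \<open>s = a\<close> and \<open>t = b\<close>.\<close>

lemma bij_betw_power_factor_pairs:
  assumes "m > 0" and ab: "coprime a b" "a > 0" "b > 0"
  shows "bij_betw (\<lambda>((d, \<delta>), (e, \<epsilon>)). (d * e, \<delta> * \<epsilon>))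
           (power_factor_pairs m a \<times> power_factor_pairs m b) (power_factor_pairs m (a * b))"
proof -
  note dvd = power_factor_pairs_dvd[OF _ \<open>m > 0\<close>]
  note gcd_prod = gcd_mult_of_coprime_dvds[OF ab(1)]
  show ?thesis
  proof (rule bij_betw_byWitness[where f' =
        "\<lambda>(x, y). ((gcd x a, gcd y a), (gcd x b, gcd y b))"])
    show "\<forall>z\<in>power_factor_pairs m a \<times> power_factor_pairs m b.
        (\<lambda>(x, y). ((gcd x a, gcd y a), (gcd x b, gcd y b)))
          ((\<lambda>((d, \<delta>), (e, \<epsilon>)). (d * e, \<delta> * \<epsilon>)) z) = z"
      using dvd gcd_prod by fastforce
    show "\<forall>z\<in>power_factor_pairs m (a * b).
        (\<lambda>((d, \<delta>), (e, \<epsilon>)). (d * e, \<delta> * \<epsilon>))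
          ((\<lambda>(x, y). ((gcd x a, gcd y a), (gcd x b, gcd y b))) z) = z"
      using dvd coprime_split_dvd[OF ab(1)] by fastforce
    show "(\<lambda>((d, \<delta>), (e, \<epsilon>)). (d * e, \<delta> * \<epsilon>)) `
        (power_factor_pairs m a \<times> power_factor_pairs m b) \<subseteq> power_factor_pairs m (a * b)"
      by (auto simp: power_factor_pairs_def power_mult_distrib algebra_simps)
    show "(\<lambda>(x, y). ((gcd x a, gcd y a), (gcd x b, gcd y b))) ` power_factor_pairs m (a * b)
        \<subseteq> power_factor_pairs m a \<times> power_factor_pairs m b"
    proof safe
      fix x y
      assume xy: "(x, y) \<in> power_factor_pairs m (a * b)"
      define s where "s = gcd x a ^ m * gcd y a"
      define t where "t = gcd x b ^ m * gcd y b"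
      have x: "x = gcd x a * gcd x b" and y: "y = gcd y a * gcd y b"
        using coprime_split_dvd[OF ab(1)] dvd[OF xy] by auto
      have "s * t = (gcd x a * gcd x b) ^ m * (gcd y a * gcd y b)"
        by (simp add: s_def t_def power_mult_distrib algebra_simps)
      also have "\<dots> = a * b"
        using xy by (simp flip: x y add: power_factor_pairs_def)
      finally have st: "s * t = a * b" .
      have "coprime (gcd x a) b" "coprime (gcd y a) b" "coprime (gcd x b) a" "coprime (gcd y b) a"
        using ab(1) coprime_divisors[of _ a b b] coprime_divisors[of _ b a a]
          coprime_commute[of a b] by simp_all
      then have cop: "coprime s b" "coprime t a"
        by (simp_all add: s_def t_def)
      have "s dvd a * b" "t dvd a * b"
        by (simp_all flip: st)
      moreover have "a dvd s * t" "b dvd s * t"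
        by (simp_all add: st)
      ultimately have "s dvd a" "t dvd b" "a dvd s" "b dvd t"
        using cop
        by (simp_all add: coprime_dvd_mult_left_iff coprime_dvd_mult_right_iff coprime_commute)
      then have "s = a" "t = b"
        by (simp_all add: dvd_antisym)
      then show "(gcd x a, gcd y a) \<in> power_factor_pairs m a"
        "(gcd x b, gcd y b) \<in> power_factor_pairs m b"
        using ab by (auto simp: power_factor_pairs_def s_def t_def)
    qed
  qed
qed

lemma multiplicative_power_convolution:
  assumes "m > 0" and f: "multiplicative f" and g: "multiplicative g"
  shows "multiplicative (power_convolution m f g)"
  unfolding multiplicative_def
proof (intro conjI allI impI)
  have "power_factor_pairs m 1 = {(1, 1)}"
    using \<open>m > 0\<close> by (auto simp: power_factor_pairs_def)
  then show "power_convolution m f g 1 = 1"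
    using f g by (simp add: power_convolution_def multiplicative_def)
next
  fix a b :: nat
  assume ab: "coprime a b" "a > 0" "b > 0"
  have factor: "f (d * e) * g (\<delta> * \<epsilon>) = (f d * g \<delta>) * (f e * g \<epsilon>)"
    if "(d, \<delta>) \<in> power_factor_pairs m a" "(e, \<epsilon>) \<in> power_factor_pairs m b" for d \<delta> e \<epsilon>
  proof -
    have pos: "d > 0" "\<delta> > 0" "e > 0" "\<epsilon> > 0"
      using that by (auto simp: power_factor_pairs_def)
    have "d dvd a" "\<delta> dvd a" "e dvd b" "\<epsilon> dvd b"
      using that power_factor_pairs_dvd \<open>m > 0\<close> by blast+
    then have "coprime d e" "coprime \<delta> \<epsilon>"
      using ab(1) coprime_divisors by blast+
    then show ?thesis
      using f g pos by (simp add: multiplicative_def algebra_simps)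
  qed
  have "power_convolution m f g (a * b) =
      (\<Sum>((d, \<delta>), (e, \<epsilon>))\<in>power_factor_pairs m a \<times> power_factor_pairs m b.
         f (d * e) * g (\<delta> * \<epsilon>))"
    unfolding power_convolution_def
    by (subst sum.reindex_bij_betw[OF bij_betw_power_factor_pairs[OF \<open>m > 0\<close> ab], symmetric])
      (simp add: case_prod_unfold)
  also have "\<dots> = (\<Sum>((d, \<delta>), (e, \<epsilon>))\<in>power_factor_pairs m a \<times> power_factor_pairs m b.
         (f d * g \<delta>) * (f e * g \<epsilon>))"
    by (rule sum.cong) (use factor in auto)
  also have "\<dots> = power_convolution m f g a * power_convolution m f g b"
    by (simp add: power_convolution_def sum_product sum.cartesian_product case_prod_unfold)
  finally show "power_convolution m f g (a * b) =
      power_convolution m f g a * power_convolution m f g b" .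
qed

lemma power_convolution_prime_power:
  assumes "prime p" "m > 0"
  shows "power_convolution m f g (p ^ \<alpha>) =
    (\<Sum>i\<le>\<alpha> div m. f (p ^ i) * g (p ^ (\<alpha> - m * i)))"
proof -
  have p: "p > 1" "p > 0"
    using prime_gt_1_nat[OF assms(1)] by auto
  have "power_factor_pairs m (p ^ \<alpha>) = (\<lambda>i. (p ^ i, p ^ (\<alpha> - m * i))) ` {..\<alpha> div m}"
  proof (intro equalityI subsetI)
    fix z
    assume pair: "z \<in> power_factor_pairs m (p ^ \<alpha>)"
    then obtain d \<delta> where z: "z = (d, \<delta>)" and d: "d ^ m * \<delta> = p ^ \<alpha>"
      by (auto simp: power_factor_pairs_def)
    have "d dvd p ^ \<alpha>" "\<delta> dvd p ^ \<alpha>"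
      using power_factor_pairs_dvd \<open>m > 0\<close> pair z by blast+
    then obtain i j where ij: "d = p ^ i" "\<delta> = p ^ j"
      using assms(1) by (metis divides_primepow_nat)
    have "p ^ (m * i + j) = p ^ \<alpha>"
      using d by (simp add: ij power_add mult.commute flip: power_mult)
    then have "m * i + j = \<alpha>"
      using p by (simp add: power_inject_exp)
    then show "z \<in> (\<lambda>i. (p ^ i, p ^ (\<alpha> - m * i))) ` {..\<alpha> div m}"
      using \<open>m > 0\<close> by (auto simp: z ij less_eq_div_iff_mult_less_eq intro!: image_eqI[of _ _ i])
  next
    fix z
    assume "z \<in> (\<lambda>i. (p ^ i, p ^ (\<alpha> - m * i))) ` {..\<alpha> div m}"
    then obtain i where z: "z = (p ^ i, p ^ (\<alpha> - m * i))" and "i \<le> \<alpha> div m"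
      by auto
    then have "m * i \<le> \<alpha>"
      using \<open>m > 0\<close> by (simp add: less_eq_div_iff_mult_less_eq mult.commute)
    then have "(p ^ i) ^ m * p ^ (\<alpha> - m * i) = p ^ \<alpha>"
      by (simp add: mult.commute[of m] flip: power_mult power_add)
    then show "z \<in> power_factor_pairs m (p ^ \<alpha>)"
      using p by (simp add: z power_factor_pairs_def)
  qed
  moreover have "inj_on (\<lambda>i. (p ^ i, p ^ (\<alpha> - m * i))) {..\<alpha> div m}"
    using p by (auto intro!: inj_onI simp: power_inject_exp)
  ultimately show ?thesis
    by (simp add: power_convolution_def sum.reindex)
qed

section \<open>Prime powers\<close>

text \<open>The exponents \<open>m * j + r\<close> with \<open>j \<ge> 1\<close> are all at least \<open>m\<close>, so past \<open>j = 0\<close> the only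
  nonzero summand is the \<open>-1\<close> at exponent \<open>m\<close>, which is reached when \<open>j = 1\<close> and \<open>r = 0\<close>.\<close>

lemma sum_gen_moebius_pp:
  assumes "1 < k" "k \<le> m" "r < m"
  shows "(\<Sum>j\<le>q. gen_moebius_pp k m (m * j + r)) =
    (if (q = 0 \<and> r = 0) \<or> r \<in> {1..k - 1} then 1 else 0)"
proof (induction q)
  case 0
  then show ?case
    using assms by (auto simp: gen_moebius_pp_def)
next
  case (Suc q)
  have "gen_moebius_pp k m (m * Suc q + r) = (if q = 0 \<and> r = 0 then -1 else 0)"
    using assms by (auto simp: gen_moebius_pp_def)
  then show ?case
    using Suc by auto
qed

lemma qstar_eq_convolution_prime_power:
  assumes "prime p" "1 < k" "k \<le> m"
  shows "qstar k m (p ^ \<alpha>) = power_convolution m (\<lambda>_. 1) (gen_moebius k m) (p ^ \<alpha>)"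
proof -
  have "power_convolution m (\<lambda>_. 1) (gen_moebius k m) (p ^ \<alpha>) =
      (\<Sum>i\<le>\<alpha> div m. gen_moebius_pp k m (\<alpha> - m * i))"
    using assms by (simp add: power_convolution_prime_power gen_moebius_prime_power)
  \<comment> \<open>Writing the exponents by their common remainder modulo \<open>m\<close> and reversing the order of
    summation brings the sum into the form of \<open>sum_gen_moebius_pp\<close>.\<close>
  also have "\<dots> = (\<Sum>i\<le>\<alpha> div m. gen_moebius_pp k m (m * (\<alpha> div m - i) + \<alpha> mod m))"
  proof (rule sum.cong[OF refl])
    fix i
    assume "i \<in> {..\<alpha> div m}"
    then have "m * i \<le> m * (\<alpha> div m)"
      by simp
    moreover have "m * (\<alpha> div m) + \<alpha> mod m = \<alpha>"
      by simp
    ultimately have "\<alpha> - m * i = m * (\<alpha> div m - i) + \<alpha> mod m"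
      unfolding diff_mult_distrib2 by linarith
    then show "gen_moebius_pp k m (\<alpha> - m * i) =
        gen_moebius_pp k m (m * (\<alpha> div m - i) + \<alpha> mod m)"
      by simp
  qed
  also have "\<dots> = (\<Sum>j\<le>\<alpha> div m. gen_moebius_pp k m (m * j + \<alpha> mod m))"
    by (rule sum.reindex_bij_witness[of _ "\<lambda>j. \<alpha> div m - j" "\<lambda>j. \<alpha> div m - j"]) auto
  also have "\<dots> = (if \<alpha> = 0 \<or> \<alpha> mod m \<in> {1..k - 1} then 1 else 0)"
  proof -
    have "\<alpha> div m = 0 \<and> \<alpha> mod m = 0 \<longleftrightarrow> \<alpha> = 0"
      by (metis div_0 mod_0 mult_0_right add_0 mult_div_mod_eq)
    moreover have "\<alpha> mod m < m"
      using assms by simp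
    ultimately show ?thesis
      using assms by (simp only: sum_gen_moebius_pp)
  qed
  finally show ?thesis
    using assms by (simp add: qstar_prime_power)
qed

lemma gen_moebius_eq_convolution_prime_power:
  assumes "prime p" "1 < k" "k \<le> m"
  shows "gen_moebius k m (p ^ \<alpha>) = power_convolution m moebius_mu (qstar k m) (p ^ \<alpha>)"
proof -
  let ?t = "\<lambda>i. moebius_mu (p ^ i) * qstar k m (p ^ (\<alpha> - m * i))"
  have "power_convolution m moebius_mu (qstar k m) (p ^ \<alpha>) = (\<Sum>i\<le>\<alpha> div m. ?t i)"
    using assms by (simp add: power_convolution_prime_power)
  \<comment> \<open>The minimum keeps \<open>i = 1\<close> only if \<open>m \<le> \<alpha>\<close>.\<close>
  also have "\<dots> = (\<Sum>i\<le>min 1 (\<alpha> div m). ?t i)"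
    by (rule sum.mono_neutral_right) (auto simp: moebius_mu_prime_power[OF assms(1)])
  also have "\<dots> = gen_moebius_pp k m \<alpha>"
  proof (cases "\<alpha> < m")
    case True
    then show ?thesis
      using assms moebius_mu_prime_power[OF assms(1), of 0]
      by (auto simp: qstar_prime_power gen_moebius_pp_def)
  next
    case False
    then have "\<alpha> div m \<ge> 1"
      using assms by (simp add: less_eq_div_iff_mult_less_eq)
    then have "(\<Sum>i\<le>min 1 (\<alpha> div m). ?t i) = qstar k m (p ^ \<alpha>) - qstar k m (p ^ (\<alpha> - m))"
      using moebius_mu_prime_power[OF assms(1), of 0] moebius_mu_prime_power[OF assms(1), of 1]
      by (simp add: min_def)
    \<comment> \<open>The exponents \<open>\<alpha>\<close> and \<open>\<alpha> - m\<close> have the same remainder, so the difference is nonzero only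
      through the exceptional exponent \<open>0\<close>, that is, for \<open>\<alpha> = m\<close>.\<close>
    also have "\<dots> = gen_moebius_pp k m \<alpha>"
      using False assms by (auto simp: qstar_prime_power gen_moebius_pp_def le_mod_geq)
    finally show ?thesis .
  qed
  finally show ?thesis
    using assms by (simp add: gen_moebius_prime_power)
qed

section \<open>The convolution identities\<close>

theorem theorem2:
  fixes k m n :: nat
  assumes "1 < k" and "k \<le> m" and "n > 0"
  shows "qstar k m n = (\<Sum>(d, \<delta>)\<in>power_factor_pairs m n. gen_moebius k m \<delta>) \<and>
         gen_moebius k m n =
           (\<Sum>(d, \<delta>)\<in>power_factor_pairs m n. moebius_mu d * qstar k m \<delta>)"
proof
  have "m > 0"
    using assms by simp
  have "qstar k m n = power_convolution m (\<lambda>_. 1) (gen_moebius k m) n"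
  proof (rule multiplicative_eqI[OF multiplicative_qstar])
    show "multiplicative (power_convolution m (\<lambda>_. 1) (gen_moebius k m))"
      using \<open>m > 0\<close> multiplicative_const_one multiplicative_gen_moebius
      by (rule multiplicative_power_convolution)
  qed (use assms qstar_eq_convolution_prime_power in auto)
  then show "qstar k m n = (\<Sum>(d, \<delta>)\<in>power_factor_pairs m n. gen_moebius k m \<delta>)"
    by (simp add: power_convolution_def)
  have "gen_moebius k m n = power_convolution m moebius_mu (qstar k m) n"
  proof (rule multiplicative_eqI[OF multiplicative_gen_moebius])
    show "multiplicative (power_convolution m moebius_mu (qstar k m))"
      using \<open>m > 0\<close> multiplicative_moebius_mu multiplicative_qstar
      by (rule multiplicative_power_convolution)
  qed (use assms gen_moebius_eq_convolution_prime_power in auto)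
  then show "gen_moebius k m n =
      (\<Sum>(d, \<delta>)\<in>power_factor_pairs m n. moebius_mu d * qstar k m \<delta>)"
    by (simp add: power_convolution_def)
qed

end
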